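(* Let $\mathrm{Coup}(E)$ be a connected coupling graph on $[n]$, $n\ge3$, and $\Gamma=(Q,C)$ a quantum circuit with $n$ qubits and $m$ gates. For every $k\in[m]$, the number of orbitals of $A^k$ under the action of $G_X$ is $$|A^k/G_X|=\frac{\sum_{\tau\in\mathbb{S}_n}|B_\tau|\cdot|E/B_\tau|}{2^p\, f!\cdot|\mathrm{Aut}(\mathrm{Coup}(E))|}.$$
   Context: Notation: $[n]=\{1,\dots,n\}$; $\mathbb{S}_n$ is the symmetric group on $[n]$; products are compositions; $\tau^{-1}(S)=\{\tau^{-1}(s):s\in S\}$. Coupling graph: a simple undirected connected graph $\mathrm{Coup}(E)=([n],E)$, with $T=\{(i~j)\in\mathbb{S}_n:\{i,j\}\in E\}$. Qubits $Q=\{q_1,\dots,q_n\}$ are identified with $[n]$; a gate is a two-element subset of $Q$; a quantum circuit is $\Gamma=(Q,C)$ with $C=(g^1,\dots,g^m)$ a sequence of gates. Fixing pattern: the gate graph $(Q,U)$ has vertex set $Q$ and edge set $U=\{g:g\in C\}$. The fixing pattern $\mathcal{F}=\{S_1,\dots,S_l\}$ is the partition of $Q$ whose parts are: each singleton consisting of a qubit in a connected component of $(Q,U)$ of size at least 3; each pair of qubits forming a connected component of size 2; and the set of all isolated vertices of $(Q,U)$ (the free set, if nonempty). $p$ is the number of such pairs and $f$ is the size of the free set. $\mathbb{S}_n(\mathcal{F})=\{a\in\mathbb{S}_n:a(S_i)=S_i\ \forall i\in[l]\}$. For $\tau\in\mathbb{S}_n$, $B_\tau=\{b\in\mathrm{Aut}(\mathrm{Coup}(E)):b(\tau^{-1}(S_i))=\tau^{-1}(S_i)\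 \forall i\in[l]\}$; it acts on $E$ by $\{i,j\}\mapsto\{b(i),b(j)\}$, and $E/B_\tau$ is the set of orbits of this action. $V^k=\{\tau^k:\tau\in\mathbb{S}_n\}$, $k\in[m]$, are disjoint copies of $\mathbb{S}_n$ and $A^k=\{(\tau^k,(\tau\sigma)^k):\tau\in\mathbb{S}_n,\sigma\in T\}$ is a set of arcs. $G_X$ is the group of permutations $\tau^k\mapsto(a\tau b^{-1})^k$ (for all $\tau\in\mathbb{S}_n$, $k\in[m]$) with $(a,b)\in\mathbb{S}_n(\mathcal{F})\times\mathrm{Aut}(\mathrm{Coup}(E))$ (additionally fixing two extra vertices $s$ and $t$); it acts on arcs by $\rho((u,v))=(\rho(u),\rho(v))$ and preserves $A^k$. The orbitals of $A^k$ are the orbits of this action on $A^k$; their set is $A^k/G_X$. *)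

theory Defs
  imports Complex_Main "HOL-Algebra.Group_Action" "HOL-Algebra.Sym_Groups"
begin

text \<open>
  All graphs have vertex set \<open>{1..n}\<close> and are given by their set of edges, which are
  two-element subsets of \<open>{1..n}\<close>. The qubit \<open>q\<^sub>i\<close> is identified with \<open>i\<close>.
\<close>

definition two_subsets :: "nat \<Rightarrow> nat set set" where
  "two_subsets n = {e. e \<subseteq> {1..n} \<and> card e = 2}"

definition reachable :: "nat set set \<Rightarrow> nat rel" where
  "reachable E = {(i, j). {i, j} \<in> E}\<^sup>*"

definition coupling_graph :: "nat \<Rightarrow> nat set set \<Rightarrow> bool" where
  "coupling_graph n E \<longleftrightarrow>
     E \<subseteq> two_subsets n \<and> (\<forall>i\<in>{1..n}. \<forall>j\<in>{1..n}. (i, j) \<in> reachable E)"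

definition quantum_circuit :: "nat \<Rightarrow> nat \<Rightarrow> nat set list \<Rightarrow> bool" where
  "quantum_circuit n m C \<longleftrightarrow> length C = m \<and> set C \<subseteq> two_subsets n"

text \<open>In the following definitions \<open>U\<close> is the edge set \<open>set C\<close> of the gate graph.\<close>

definition component :: "nat \<Rightarrow> nat set set \<Rightarrow> nat \<Rightarrow> nat set" where
  "component n U q = {r \<in> {1..n}. (q, r) \<in> reachable U}"

definition pair_components :: "nat \<Rightarrow> nat set set \<Rightarrow> nat set set" where
  "pair_components n U = {K \<in> component n U ` {1..n}. card K = 2}"

definition free_set :: "nat \<Rightarrow> nat set set \<Rightarrow> nat set" where
  "free_set n U = {q \<in> {1..n}. \<forall>g\<in>U. q \<notin> g}"

definition fixing_pattern :: "nat \<Rightarrow> nat set set \<Rightarrow> nat set set" where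
  "fixing_pattern n U =
     {{q} | q. q \<in> {1..n} \<and> card (component n U q) \<ge> 3}
     \<union> pair_components n U
     \<union> (if free_set n U = {} then {} else {free_set n U})"

definition pattern_stabilizer :: "nat \<Rightarrow> nat set set \<Rightarrow> (nat \<Rightarrow> nat) set" where
  "pattern_stabilizer n F = {a \<in> carrier (sym_group n). \<forall>S\<in>F. a ` S = S}"

definition graph_aut :: "nat \<Rightarrow> nat set set \<Rightarrow> (nat \<Rightarrow> nat) set" where
  "graph_aut n E = {b \<in> carrier (sym_group n).
     \<forall>i\<in>{1..n}. \<forall>j\<in>{1..n}. {i, j} \<in> E \<longleftrightarrow> {b i, b j} \<in> E}"

text \<open>The symbol \<open>inv'\<close> of \<^theory>\<open>HOL-Algebra.Sym_Groups\<close> is the inverse function.\<close>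

definition B_set :: "nat \<Rightarrow> nat set set \<Rightarrow> nat set set \<Rightarrow> (nat \<Rightarrow> nat) \<Rightarrow> (nat \<Rightarrow> nat) set" where
  "B_set n E F \<tau> = {b \<in> graph_aut n E. \<forall>S\<in>F. b ` (inv' \<tau> ` S) = inv' \<tau> ` S}"

definition B_group :: "nat \<Rightarrow> nat set set \<Rightarrow> nat set set \<Rightarrow> (nat \<Rightarrow> nat) \<Rightarrow> (nat \<Rightarrow> nat) monoid" where
  "B_group n E F \<tau> = (sym_group n) \<lparr>carrier := B_set n E F \<tau>\<rparr>"

text \<open>
  Actions in the sense of \<^theory>\<open>HOL-Algebra.Group_Action\<close> map into \<^const>\<open>BijGroup\<close>, whose
  elements are extensional functions; hence the restrictions to \<open>E\<close> here and to the set of arcs below.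
\<close>

definition edge_action :: "nat set set \<Rightarrow> (nat \<Rightarrow> nat) \<Rightarrow> nat set \<Rightarrow> nat set" where
  "edge_action E b = (\<lambda>e\<in>E. b ` e)"

definition edge_orbits :: "nat \<Rightarrow> nat set set \<Rightarrow> nat set set \<Rightarrow> (nat \<Rightarrow> nat) \<Rightarrow> nat set set set" where
  "edge_orbits n E F \<tau> = orbits (B_group n E F \<tau>) E (edge_action E)"

definition coupling_transpositions :: "nat set set \<Rightarrow> (nat \<Rightarrow> nat) set" where
  "coupling_transpositions E = {transpose i j | i j. {i, j} \<in> E}"

text \<open>\<open>Copy k \<tau>\<close> stands for the vertex \<open>\<tau>\<^sup>k\<close>, and \<open>Source\<close>, \<open>Sink\<close> for the extra vertices \<open>s\<close>, \<open>t\<close>.\<close>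

datatype vertex = Source | Sink | Copy nat "nat \<Rightarrow> nat"

definition arcs :: "nat \<Rightarrow> nat set set \<Rightarrow> nat \<Rightarrow> (vertex \<times> vertex) set" where
  "arcs n E k = {(Copy k \<tau>, Copy k (\<tau> \<circ> \<sigma>)) | \<tau> \<sigma>.
     \<tau> \<in> carrier (sym_group n) \<and> \<sigma> \<in> coupling_transpositions E}"

text \<open>
  The type \<^typ>\<open>vertex\<close> also contains terms \<open>Copy k \<tau>\<close> that are not vertices
  (\<open>k \<notin> {1..m}\<close> or \<open>\<tau>\<close> not a permutation of \<open>{1..n}\<close>); they are fixed as well.
\<close>

fun vertex_perm :: "nat \<Rightarrow> nat \<Rightarrow> (nat \<Rightarrow> nat) \<Rightarrow> (nat \<Rightarrow> nat) \<Rightarrow> vertex \<Rightarrow> vertex" where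
  "vertex_perm n m a b Source = Source"
| "vertex_perm n m a b Sink = Sink"
| "vertex_perm n m a b (Copy k \<tau>) =
     (if k \<in> {1..m} \<and> \<tau> \<in> carrier (sym_group n) then Copy k (a \<circ> \<tau> \<circ> inv' b) else Copy k \<tau>)"

definition G_X :: "nat \<Rightarrow> nat \<Rightarrow> nat set set \<Rightarrow> nat set set \<Rightarrow> (vertex \<Rightarrow> vertex) monoid" where
  "G_X n m E F =
     \<lparr>carrier = {vertex_perm n m a b | a b. a \<in> pattern_stabilizer n F \<and> b \<in> graph_aut n E},
      monoid.mult = (\<circ>), one = id\<rparr>"

definition arc_action ::
  "nat \<Rightarrow> nat set set \<Rightarrow> nat \<Rightarrow> (vertex \<Rightarrow> vertex) \<Rightarrow> vertex \<times> vertex \<Rightarrow> vertex \<times> vertex" where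
  "arc_action n E k \<rho> = (\<lambda>(u, v)\<in>arcs n E k. (\<rho> u, \<rho> v))"

definition orbitals ::
  "nat \<Rightarrow> nat \<Rightarrow> nat set set \<Rightarrow> nat set set \<Rightarrow> nat \<Rightarrow> (vertex \<times> vertex) set set" where
  "orbitals n m E F k = orbits (G_X n m E F) (arcs n E k) (arc_action n E k)"

end

theory Submission
  imports Defs
begin

text \<open>
  Let \<open>H\<close> be the direct product of the stabilizer \<open>S\<^sub>n(F)\<close> of the fixing pattern and the
  automorphism group of the coupling graph. An arc \<open>(\<tau>, \<tau> \<circ> \<sigma>)\<close> is determined by \<open>\<tau>\<close> and the edge
  whose ends \<open>\<sigma>\<close> exchanges, so the arcs of one copy are in bijection with the pairs \<open>(\<tau>, e)\<close> of a
  permutation and an edge. Since \<open>b \<circ> (i j) \<circ> b\<inverse> = (b i b j)\<close>, the action on arcs becomes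
  \<open>(a, b) \<cdot> (\<tau>, e) = (a \<circ> \<tau> \<circ> b\<inverse>, b(e))\<close>. The elements of \<open>G_X\<close> are exactly the permutations
  induced by \<open>H\<close>, so the orbitals correspond to the orbits of \<open>H\<close> on these pairs
  (\<open>orbitals_eq\<close>), even where different elements of \<open>H\<close> induce the same permutation.

  For a finite group acting on a finite set, the stabilizer sizes of all points sum to the number of
  orbits times the order of the group. This is used twice. If \<open>(a, b)\<close> fixes \<open>(\<tau>, e)\<close>, then
  \<open>a = \<tau> \<circ> b \<circ> \<tau>\<inverse>\<close>, and such an \<open>a\<close> preserves every part \<open>S\<close> exactly if \<open>b\<close> preserves every
  \<open>\<tau>\<inverse>(S)\<close>; hence the stabilizer of \<open>(\<tau>, e)\<close> in \<open>H\<close> has the size of the stabilizer of \<open>e\<close> in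
  \<open>B\<^sub>\<tau>\<close> (\<open>card_stabilizer_flag\<close>). Summed over \<open>e\<close>, these sizes give \<open>|B\<^sub>\<tau>| \<cdot> |E/B\<^sub>\<tau>|\<close>; summed over
  \<open>\<tau>\<close> as well, they give the number of orbitals times \<open>|H|\<close> (\<open>card_flag_orbits\<close>).

  It remains to find the order of \<open>S\<^sub>n(F)\<close>. This is a Young subgroup, so its order is the product of
  the factorials of the sizes of the parts (\<open>card_young_subgroup\<close>): a singleton contributes 1, a pair
  contributes 2, and the free set contributes \<open>f!\<close>.
\<close>

section \<open>Counting orbits\<close>

text \<open>
  A group action must map into extensional functions; this lemma derives one from an operation that
  satisfies the action laws on the acted set only.
\<close>

lemma group_action_restrict:
  fixes G (structure)
  assumes "group G"
    and closed: "\<And>g x. g \<in> carrier G \<Longrightarrow> x \<in> X \<Longrightarrow> f g x \<in> X"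
    and one: "\<And>x. x \<in> X \<Longrightarrow> f \<one> x = x"
    and mult: "\<And>g h x. g \<in> carrier G \<Longrightarrow> h \<in> carrier G \<Longrightarrow> x \<in> X \<Longrightarrow>
      f (g \<otimes> h) x = f g (f h x)"
  shows "group_action G X (\<lambda>g. \<lambda>x\<in>X. f g x)"
proof -
  interpret group G by fact
  have inverse: "f (inv g) (f g x) = x" "f g (f (inv g) x) = x" if "g \<in> carrier G" "x \<in> X" for g x
    using that one mult[of "inv g" g x] mult[of g "inv g" x] by simp_all
  have Bij: "(\<lambda>x\<in>X. f g x) \<in> Bij X" if "g \<in> carrier G" for g
  proof -
    have "bij_betw (f g) X X"
      by (rule bij_betw_byWitness[where f' = "f (inv g)"]) (use that inverse closed in auto)
    then show ?thesis
      unfolding Bij_def by (simp add: bij_betw_restrict_eq)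
  qed
  have "(\<lambda>g. \<lambda>x\<in>X. f g x) \<in> hom G (BijGroup X)"
    unfolding hom_def BijGroup_def
    by (auto simp: Bij compose_def mult closed intro!: restrict_ext)
  then show ?thesis
    unfolding group_action_def group_hom_def group_hom_axioms_def
    using group_BijGroup is_group by blast
qed

text \<open>By the orbit-stabilizer theorem each orbit contributes the order of the group to the sum.\<close>

lemma (in group_action) sum_card_stabilizer:
  assumes "finite (carrier G)" "finite E"
  shows "(\<Sum>x\<in>E. card (stabilizer G \<phi> x)) = card (orbits G E \<phi>) * order G"
  using disjoint_sum[OF assms(2), of "\<lambda>x. card (stabilizer G \<phi> x)"] card_stablizer_sum[OF assms(1)]
  by simp

section \<open>The order of a Young subgroup\<close>

definition young_subgroup :: "'a set set \<Rightarrow> ('a \<Rightarrow> 'a) set" where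
  "young_subgroup P = {a. a permutes \<Union>P \<and> (\<forall>S\<in>P. a ` S = S)}"

text \<open>
  Restricting to a new part \<open>S\<close> and to the union of the old parts splits a permutation into two
  commuting factors that can be chosen independently.
\<close>

lemma card_young_subgroup_insert:
  assumes "finite S" "S \<inter> \<Union>P = {}" "finite (\<Union>P)"
  shows "card (young_subgroup (insert S P)) = fact (card S) * card (young_subgroup P)"
proof -
  let ?A = "{u. u permutes S} \<times> young_subgroup P"
  let ?f = "\<lambda>(u, v). u \<circ> v"
  have "bij_betw ?f ?A (young_subgroup (insert S P))"
  proof (rule bij_betw_byWitness[where f' = "\<lambda>a. (restrict_id a S, restrict_id a (\<Union>P))"])
    have comp: "(u \<circ> v) x = (if x \<in> S then u x else v x)"
      if "u permutes S" "v permutes \<Union>P" for u v x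
    proof (cases "x \<in> S")
      case True
      then have "v x = x" using assms(2) permutes_not_in[OF that(2)] by blast
      then show ?thesis using True by simp
    next
      case False
      then have "v x \<notin> S"
        using assms(2) permutes_in_image[OF that(2), of x] permutes_not_in[OF that(2), of x] by auto
      then show ?thesis using False permutes_not_in[OF that(1)] by auto
    qed
    show "\<forall>z\<in>?A. (restrict_id (?f z) S, restrict_id (?f z) (\<Union>P)) = z"
    proof (clarify, rule conjI)
      fix u v assume u: "u permutes S" and "v \<in> young_subgroup P"
      then have v: "v permutes \<Union>P" by (simp add: young_subgroup_def)
      show "restrict_id (u \<circ> v) S = u"
        using comp[OF u v] permutes_not_in[OF u] by (auto simp: restrict_id_def fun_eq_iff)
      show "restrict_id (u \<circ> v) (\<Union>P) = v"
        using comp[OF u v] permutes_not_in[OF v] assms(2)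
        by (fastforce simp: restrict_id_def fun_eq_iff)
    qed
    show "?f ` ?A \<subseteq> young_subgroup (insert S P)"
    proof clarify
      fix u v assume u: "u permutes S" and "v \<in> young_subgroup P"
      then have v: "v permutes \<Union>P" "\<forall>T\<in>P. v ` T = T" by (simp_all add: young_subgroup_def)
      have "u permutes \<Union>(insert S P)" "v permutes \<Union>(insert S P)"
        using u v(1) by (auto elim: permutes_subset)
      then have "(u \<circ> v) permutes \<Union>(insert S P)" by (rule permutes_compose[rotated])
      moreover have "(u \<circ> v) ` S = u ` S"
        by (intro image_cong) (auto simp: comp[OF u v(1), unfolded comp_apply])
      moreover have "(u \<circ> v) ` T = v ` T" if "T \<in> P" for T
        using that assms(2) by (intro image_cong) (auto simp: comp[OF u v(1), unfolded comp_apply])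
      ultimately show "u \<circ> v \<in> young_subgroup (insert S P)"
        using v(2) permutes_image[OF u] by (auto simp: young_subgroup_def)
    qed
    have rest: "restrict_id a S permutes S" "restrict_id a (\<Union>P) \<in> young_subgroup P"
      "restrict_id a S \<circ> restrict_id a (\<Union>P) = a"
      if "a \<in> young_subgroup (insert S P)" for a
    proof -
      have a: "a permutes \<Union>(insert S P)" "a ` S = S" "\<And>T. T \<in> P \<Longrightarrow> a ` T = T"
        using that by (auto simp: young_subgroup_def)
      have "inj a" using a(1) by (rule permutes_inj)
      show 1: "restrict_id a S permutes S"
        by (rule permutes_restrict_id) (use a(2) \<open>inj a\<close> in \<open>auto simp: bij_betw_def intro: inj_on_subset\<close>)
      have "a ` \<Union>P = (\<Union>T\<in>P. a ` T)" by auto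
      also have "\<dots> = \<Union>P" using a(3) by auto
      finally have 2: "restrict_id a (\<Union>P) permutes \<Union>P"
        by (intro permutes_restrict_id) (use \<open>inj a\<close> in \<open>auto simp: bij_betw_def intro: inj_on_subset\<close>)
      have "restrict_id a (\<Union>P) ` T = a ` T" if "T \<in> P" for T
        using that by (intro image_cong) (auto simp: restrict_id_def)
      then show "restrict_id a (\<Union>P) \<in> young_subgroup P"
        using 2 a(3) by (simp add: young_subgroup_def)
      show "restrict_id a S \<circ> restrict_id a (\<Union>P) = a"
        using comp[OF 1 2] permutes_not_in[OF a(1)] by (auto simp: fun_eq_iff restrict_id_def)
    qed
    show "\<forall>a\<in>young_subgroup (insert S P). ?f (restrict_id a S, restrict_id a (\<Union>P)) = a"
      using rest(3) by simp
    show "(\<lambda>a. (restrict_id a S, restrict_id a (\<Union>P))) ` young_subgroup (insert S P) \<subseteq> ?A"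
      using rest(1,2) by auto
  qed
  then have "card (young_subgroup (insert S P)) = card ?A"
    by (simp add: bij_betw_same_card)
  then show ?thesis
    using card_permutations[OF refl assms(1)] by (simp add: card_cartesian_product)
qed

lemma card_young_subgroup:
  assumes "finite P" "\<And>S. S \<in> P \<Longrightarrow> finite S"
    and "pairwise disjnt P"
  shows "card (young_subgroup P) = (\<Prod>S\<in>P. fact (card S))"
  using assms
proof (induction P rule: finite_induct)
  case empty
  have "young_subgroup {} = {id :: 'a \<Rightarrow> 'a}" by (auto simp: young_subgroup_def)
  then show ?case by simp
next
  case (insert S P)
  then have "S \<inter> \<Union>P = {}" by (fastforce simp: pairwise_insert disjnt_def)
  with insert show ?case
    by (subst card_young_subgroup_insert) (auto simp: pairwise_insert)
qed

section \<open>Fixing patterns\<close>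

context
  fixes n :: nat and U :: "nat set set"
  assumes U: "U \<subseteq> two_subsets n"
begin

lemma equiv_reachable: "equiv UNIV (reachable U)"
  unfolding reachable_def
  by (intro equivI refl_rtrancl sym_rtrancl trans_rtrancl) (auto simp: sym_def insert_commute)

lemma component_self: "q \<in> {1..n} \<Longrightarrow> q \<in> component n U q"
  by (simp add: component_def reachable_def)

lemma component_eq:
  assumes "r \<in> component n U q" shows "component n U r = component n U q"
proof -
  have "(q, r) \<in> reachable U" using assms by (simp add: component_def)
  then have "reachable U `` {q} = reachable U `` {r}"
    using equiv_class_eq[OF equiv_reachable] by blast
  moreover have "component n U x = {1..n} \<inter> reachable U `` {x}" for x
    by (auto simp: component_def)
  ultimately show ?thesis by simp
qed

text \<open>
  The size of the component of a qubit decides which kind of part contains the qubit. Size 1 means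
  isolated because every gate has two distinct ends.
\<close>

lemma free_set_iff_component:
  assumes "q \<in> {1..n}"
  shows "q \<in> free_set n U \<longleftrightarrow> card (component n U q) = 1"
proof
  assume q: "q \<in> free_set n U"
  have "r = q" if "(q, r) \<in> reachable U" for r
    using that unfolding reachable_def
    by (induction rule: rtrancl_induct) (use q in \<open>auto simp: free_set_def\<close>)
  then have "component n U q = {q}"
    using assms component_self by (auto simp: component_def)
  then show "card (component n U q) = 1" by simp
next
  assume "card (component n U q) = 1"
  then have single: "component n U q = {q}"
    using component_self[OF assms] by (auto simp: card_1_singleton_iff)
  show "q \<in> free_set n U"
  proof (rule ccontr)
    assume "q \<notin> free_set n U"
    then obtain g where g: "g \<in> U" "q \<in> g" using assms by (auto simp: free_set_def)
    then have "card g = 2" "g \<subseteq> {1..n}" using U by (auto simp: two_subsets_def)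
    then obtain r where "g = {q, r}" "r \<noteq> q" "r \<in> {1..n}"
      using g(2) by (metis card_2_iff insertE insert_commute insert_subset singletonD)
    then have "r \<in> component n U q"
      using g(1) by (auto simp: component_def reachable_def)
    then show False using single \<open>r \<noteq> q\<close> by simp
  qed
qed

lemma card_component_pos: "q \<in> {1..n} \<Longrightarrow> card (component n U q) > 0"
  using component_self[of q] by (auto simp: card_gt_0_iff component_def)

lemma pair_components_memD:
  assumes "K \<in> pair_components n U" "q \<in> K"
  shows "K = component n U q" "q \<in> {1..n}" "card K = 2"
proof -
  obtain r where r: "r \<in> {1..n}" "K = component n U r" "card K = 2"
    using assms(1) by (auto simp: pair_components_def)
  then show "K = component n U q" using component_eq[of q r] assms(2) by simp
  show "q \<in> {1..n}" using r assms(2) by (simp add: component_def)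
  show "card K = 2" by fact
qed

lemma Union_fixing_pattern: "\<Union>(fixing_pattern n U) = {1..n}"
proof
  show "\<Union>(fixing_pattern n U) \<subseteq> {1..n}"
  proof (rule Union_least)
    fix S assume "S \<in> fixing_pattern n U"
    then consider r where "S = {r}" "r \<in> {1..n}" | "S \<in> pair_components n U" | "S = free_set n U"
      by (auto simp: fixing_pattern_def split: if_splits)
    then show "S \<subseteq> {1..n}"
    proof cases
      case 2
      then show ?thesis using pair_components_memD(2) by blast
    qed (auto simp: free_set_def)
  qed
  show "{1..n} \<subseteq> \<Union>(fixing_pattern n U)"
  proof
    fix q assume q: "q \<in> {1..n}"
    consider "card (component n U q) \<ge> 3" | "card (component n U q) = 2" | "card (component n U q) = 1"
      using card_component_pos[OF q] by linarith
    then show "q \<in> \<Union>(fixing_pattern n U)"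
    proof cases
      case 1
      then have "{q} \<in> fixing_pattern n U" using q unfolding fixing_pattern_def by blast
      then show ?thesis by (rule UnionI) simp
    next
      case 2
      then have "component n U q \<in> fixing_pattern n U"
        using q unfolding fixing_pattern_def pair_components_def by blast
      then show ?thesis using component_self[OF q] by (rule UnionI)
    next
      case 3
      then have free: "q \<in> free_set n U" using free_set_iff_component[OF q] by simp
      then have "free_set n U \<in> fixing_pattern n U" by (auto simp: fixing_pattern_def)
      then show ?thesis using free by (rule UnionI)
    qed
  qed
qed

text \<open>A part is recovered from any one of its qubits, so distinct parts are disjoint.\<close>

lemma fixing_pattern_part:
  assumes "S \<in> fixing_pattern n U" "q \<in> S"
  shows "S = (if card (component n U q) \<ge> 3 then {q}
    else if card (component n U q) = 2 then component n U q else free_set n U)"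
proof -
  consider r where "S = {r}" "card (component n U r) \<ge> 3" | "S \<in> pair_components n U"
    | "S = free_set n U"
    using assms(1) by (auto simp: fixing_pattern_def split: if_splits)
  then show ?thesis
  proof cases
    case 1
    then show ?thesis using assms(2) by auto
  next
    case 2
    then show ?thesis using pair_components_memD[OF _ assms(2)] by auto
  next
    case 3
    then have "card (component n U q) = 1"
      using assms(2) free_set_iff_component[of q] by (auto simp: free_set_def)
    then show ?thesis using 3 by simp
  qed
qed

lemma pairwise_disjnt_fixing_pattern: "pairwise disjnt (fixing_pattern n U)"
proof (rule pairwiseI, rule ccontr)
  fix S T assume ST: "S \<in> fixing_pattern n U" "T \<in> fixing_pattern n U" "S \<noteq> T" "\<not> disjnt S T"
  then obtain q where "q \<in> S" "q \<in> T" by (auto simp: disjnt_def)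
  then have "S = T"
    using ST by (intro trans[OF fixing_pattern_part fixing_pattern_part[symmetric]])
  with ST(3) show False by contradiction
qed

text \<open>
  The three kinds of parts contain qubits with components of different sizes, so no part is counted
  twice. If the free set is empty, it is not a part, in accordance with \<open>0! = 1\<close>.
\<close>

lemma prod_fact_fixing_pattern:
  "(\<Prod>S\<in>fixing_pattern n U. fact (card S)) =
     (2 :: nat) ^ card (pair_components n U) * fact (card (free_set n U))"
proof -
  define Singles where "Singles = {{q} | q. q \<in> {1..n} \<and> card (component n U q) \<ge> 3}"
  define Free where "Free = (if free_set n U = {} then {} else {free_set n U})"
  have F: "fixing_pattern n U = (Singles \<union> pair_components n U) \<union> Free"
    by (simp add: fixing_pattern_def Singles_def Free_def)
  have fin: "finite Singles" "finite (pair_components n U)" "finite Free"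
    by (simp_all add: Singles_def pair_components_def Free_def)
  have 1: "Singles \<inter> pair_components n U = {}"
    by (auto simp: Singles_def pair_components_def)
  have 2: "(Singles \<union> pair_components n U) \<inter> Free = {}"
  proof (rule ccontr)
    assume "(Singles \<union> pair_components n U) \<inter> Free \<noteq> {}"
    then have ne: "free_set n U \<noteq> {}" and S: "free_set n U \<in> Singles \<union> pair_components n U"
      by (auto simp: Free_def split: if_splits)
    from ne obtain q where q: "q \<in> free_set n U" by blast
    then have one: "card (component n U q) = 1"
      using free_set_iff_component[of q] by (auto simp: free_set_def)
    show False
    proof (cases "free_set n U \<in> Singles")
      case True
      then show False using q one by (auto simp: Singles_def)
    next
      case False
      then have "free_set n U \<in> pair_components n U" using S by simp
      then show False using pair_components_memD[OF _ q] one by simp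
    qed
  qed
  have "(\<Prod>S\<in>Singles. fact (card S)) = (1 :: nat)"
    by (intro prod.neutral) (auto simp: Singles_def)
  moreover have "(\<Prod>S\<in>pair_components n U. fact (card S)) =
      (\<Prod>S\<in>pair_components n U. (2 :: nat))"
    by (intro prod.cong) (auto simp: pair_components_def fact_2)
  moreover have "(\<Prod>S\<in>Free. fact (card S)) = (fact (card (free_set n U)) :: nat)"
    by (simp add: Free_def)
  ultimately show ?thesis
    unfolding F using fin 1 2 by (simp add: prod.union_disjoint)
qed

lemma card_pattern_stabilizer:
  "card (pattern_stabilizer n (fixing_pattern n U)) =
     2 ^ card (pair_components n U) * fact (card (free_set n U))"
proof -
  have "pattern_stabilizer n (fixing_pattern n U) = young_subgroup (fixing_pattern n U)"
    by (simp add: pattern_stabilizer_def young_subgroup_def Union_fixing_pattern sym_group_carrier)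
  then have "card (pattern_stabilizer n (fixing_pattern n U)) =
      card (young_subgroup (fixing_pattern n U))"
    by (rule arg_cong)
  also have "card (young_subgroup (fixing_pattern n U)) =
      (\<Prod>S\<in>fixing_pattern n U. fact (card S))"
  proof (rule card_young_subgroup)
    show "finite (fixing_pattern n U)"
      by (rule finite_UnionD, subst Union_fixing_pattern) (rule finite_atLeastAtMost)
    show "finite S" if "S \<in> fixing_pattern n U" for S
      using Union_upper[OF that] unfolding Union_fixing_pattern
      by (rule finite_subset) (rule finite_atLeastAtMost)
    show "pairwise disjnt (fixing_pattern n U)" by (rule pairwise_disjnt_fixing_pattern)
  qed
  also have "\<dots> = 2 ^ card (pair_components n U) * fact (card (free_set n U))"
    by (rule prod_fact_fixing_pattern)
  finally show ?thesis .
qed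

end

section \<open>The acting groups\<close>

lemma finite_sym_group: "finite (carrier (sym_group n))"
  by (simp add: sym_group_def finite_permutations)

lemma subgroup_sym_groupI:
  assumes "H \<subseteq> carrier (sym_group n)" "id \<in> H"
    and "\<And>a b. a \<in> H \<Longrightarrow> b \<in> H \<Longrightarrow> a \<circ> b \<in> H"
    and "\<And>a. a \<in> H \<Longrightarrow> inv' a \<in> H"
  shows "subgroup H (sym_group n)"
proof (rule group.subgroupI[OF sym_group_is_group assms(1)])
  show "H \<noteq> {}" using assms(2) by blast
  show "inv\<^bsub>sym_group n\<^esub> a \<in> H" if "a \<in> H" for a
    using assms(1,4) that by (simp add: subsetD)
  show "a \<otimes>\<^bsub>sym_group n\<^esub> b \<in> H" if "a \<in> H" "b \<in> H" for a b
    using assms(3) that by (simp add: sym_group_mult)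
qed

lemma subgroup_pattern_stabilizer: "subgroup (pattern_stabilizer n P) (sym_group n)"
proof (rule subgroup_sym_groupI)
  fix a assume a: "a \<in> pattern_stabilizer n P"
  then have "inj a" by (auto simp: pattern_stabilizer_def sym_group_carrier permutes_inj)
  have "inv' a ` S = S" if "S \<in> P" for S
  proof -
    have "inv' a ` S = inv' a ` (a ` S)" using a that by (simp add: pattern_stabilizer_def)
    then show ?thesis using \<open>inj a\<close> by (simp add: image_inv_f_f)
  qed
  then show "inv' a \<in> pattern_stabilizer n P"
    using a by (simp add: pattern_stabilizer_def sym_group_inv_closed)
next
  fix a b assume ab: "a \<in> pattern_stabilizer n P" "b \<in> pattern_stabilizer n P"
  then have "(a \<circ> b) ` S = S" if "S \<in> P" for S
    using that image_comp[of a b S] by (simp add: pattern_stabilizer_def)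
  then show "a \<circ> b \<in> pattern_stabilizer n P"
    using ab by (simp add: pattern_stabilizer_def sym_group_carrier permutes_compose)
qed (auto simp: pattern_stabilizer_def sym_group_carrier permutes_id)

text \<open>The equivalence is oriented so that it terminates as a rewrite rule.\<close>

lemma graph_aut_iff:
  "b \<in> graph_aut n E \<longleftrightarrow> b permutes {1..n} \<and>
    (\<forall>i\<in>{1..n}. \<forall>j\<in>{1..n}. {b i, b j} \<in> E \<longleftrightarrow> {i, j} \<in> E)"
  unfolding graph_aut_def sym_group_carrier mem_Collect_eq by blast

lemma subgroup_graph_aut: "subgroup (graph_aut n E) (sym_group n)"
proof (rule subgroup_sym_groupI)
  fix a b assume a: "a \<in> graph_aut n E" and b: "b \<in> graph_aut n E"
  then have "b permutes {1..n}" by (simp add: graph_aut_iff)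
  then have "b i \<in> {1..n} \<longleftrightarrow> i \<in> {1..n}" for i by (rule permutes_in_image)
  then show "a \<circ> b \<in> graph_aut n E"
    using a b unfolding graph_aut_iff by (simp add: permutes_compose)
next
  fix a assume a: "a \<in> graph_aut n E"
  then have p: "a permutes {1..n}" by (simp add: graph_aut_iff)
  have "{inv' a i, inv' a j} \<in> E \<longleftrightarrow> {i, j} \<in> E" if "i \<in> {1..n}" "j \<in> {1..n}" for i j
  proof -
    have "inv' a i \<in> {1..n}" "inv' a j \<in> {1..n}"
      using that permutes_in_image[OF permutes_inv[OF p]] by blast+
    then have "{a (inv' a i), a (inv' a j)} \<in> E \<longleftrightarrow> {inv' a i, inv' a j} \<in> E"
      using a unfolding graph_aut_iff by blast
    then show ?thesis by (simp add: permutes_inverses[OF p])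
  qed
  then show "inv' a \<in> graph_aut n E"
    using permutes_inv[OF p] unfolding graph_aut_iff by blast
qed (simp_all add: graph_aut_iff permutes_id sym_group_carrier subset_iff)

text \<open>Writing \<open>B\<^sub>\<tau>\<close> as an intersection of two subgroups shows that it is a group.\<close>

lemma B_set_eq:
  "B_set n E F \<tau> = graph_aut n E \<inter> pattern_stabilizer n ((`) (inv' \<tau>) ` F)"
  by (auto simp: B_set_def graph_aut_def pattern_stabilizer_def)

lemma group_B_group: "group (B_group n E F \<tau>)"
  unfolding B_group_def B_set_eq
  by (intro subgroup.subgroup_is_group[OF group.subgroups_Inter_pair] sym_group_is_group
      subgroup_graph_aut subgroup_pattern_stabilizer)

lemma graph_aut_image_edge:
  assumes "E \<subseteq> two_subsets n" "b \<in> graph_aut n E" "e \<in> E"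
  shows "b ` e \<in> E"
proof -
  have e: "e \<subseteq> {1..n}" "card e = 2" using assms(1,3) by (auto simp: two_subsets_def)
  then obtain i j where "e = {i, j}" by (auto simp: card_2_iff)
  then show ?thesis using assms(2,3) e(1) by (simp add: graph_aut_iff)
qed

lemma group_action_edges:
  assumes "E \<subseteq> two_subsets n"
  shows "group_action (B_group n E F \<tau>) E (edge_action E)"
  unfolding edge_action_def[abs_def]
proof (rule group_action_restrict[OF group_B_group])
  fix b e assume "b \<in> carrier (B_group n E F \<tau>)" "e \<in> E"
  then show "b ` e \<in> E"
    using graph_aut_image_edge[OF assms] by (simp add: B_group_def B_set_def)
qed (auto simp: B_group_def sym_group_def image_comp)

section \<open>The action on flags\<close>

definition pair_group :: "nat \<Rightarrow> nat set set \<Rightarrow> nat set set \<Rightarrow> ((nat \<Rightarrow> nat) \<times> (nat \<Rightarrow> nat)) monoid" where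
  "pair_group n E F =
     (sym_group n)\<lparr>carrier := pattern_stabilizer n F\<rparr> \<times>\<times> (sym_group n)\<lparr>carrier := graph_aut n E\<rparr>"

text \<open>
  A flag \<open>(\<tau>, e)\<close> stands for the arc that leaves \<open>\<tau>\<close> along the transposition of the ends of \<open>e\<close>.
\<close>

definition flags :: "nat \<Rightarrow> nat set set \<Rightarrow> ((nat \<Rightarrow> nat) \<times> nat set) set" where
  "flags n E = carrier (sym_group n) \<times> E"

definition move_flag ::
  "(nat \<Rightarrow> nat) \<times> (nat \<Rightarrow> nat) \<Rightarrow> (nat \<Rightarrow> nat) \<times> nat set \<Rightarrow> (nat \<Rightarrow> nat) \<times> nat set" where
  "move_flag = (\<lambda>(a, b) (\<tau>, e). (a \<circ> \<tau> \<circ> inv' b, b ` e))"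

abbreviation flag_action where
  "flag_action n E \<equiv> (\<lambda>g. \<lambda>x\<in>flags n E. move_flag g x)"

lemma carrier_pair_group: "carrier (pair_group n E F) = pattern_stabilizer n F \<times> graph_aut n E"
  by (simp add: pair_group_def)

lemma pair_group_permutes:
  assumes "(a, b) \<in> carrier (pair_group n E F)"
  shows "a permutes {1..n}" "b permutes {1..n}"
  using assms by (auto simp: carrier_pair_group pattern_stabilizer_def graph_aut_def sym_group_carrier)

lemma move_flag_closed:
  assumes "E \<subseteq> two_subsets n" "g \<in> carrier (pair_group n E F)" "x \<in> flags n E"
  shows "move_flag g x \<in> flags n E"
proof -
  obtain a b \<tau> e where gx: "g = (a, b)" "x = (\<tau>, e)" by (metis surj_pair)
  have ab: "a permutes {1..n}" "b permutes {1..n}" "b \<in> graph_aut n E"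
    using pair_group_permutes assms(2) gx by (auto simp: carrier_pair_group)
  have \<tau>: "\<tau> permutes {1..n}" "e \<in> E"
    using assms(3) gx by (simp_all add: flags_def sym_group_carrier)
  show ?thesis
    using graph_aut_image_edge[OF assms(1) ab(3) \<tau>(2)]
      permutes_compose[OF permutes_compose[OF permutes_inv[OF ab(2)] \<tau>(1)] ab(1)]
    by (simp add: gx move_flag_def flags_def sym_group_carrier comp_assoc)
qed

lemma group_action_flags:
  assumes "E \<subseteq> two_subsets n"
  shows "group_action (pair_group n E F) (flags n E) (flag_action n E)"
proof (rule group_action_restrict)
  show "group (pair_group n E F)"
    unfolding pair_group_def
    by (intro DirProd_group subgroup.subgroup_is_group[OF _ sym_group_is_group]
        subgroup_pattern_stabilizer subgroup_graph_aut)
  show "move_flag g x \<in> flags n E" if "g \<in> carrier (pair_group n E F)" "x \<in> flags n E" for g x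
    using move_flag_closed[OF assms that] .
  show "move_flag \<one>\<^bsub>pair_group n E F\<^esub> x = x" for x
    by (simp add: pair_group_def sym_group_one move_flag_def split: prod.split)
  show "move_flag (g \<otimes>\<^bsub>pair_group n E F\<^esub> h) x = move_flag g (move_flag h x)"
    if "g \<in> carrier (pair_group n E F)" "h \<in> carrier (pair_group n E F)" for g h x
  proof -
    obtain a b c d \<tau> e where ghx: "g = (a, b)" "h = (c, d)" "x = (\<tau>, e)" by (metis surj_pair)
    have "bij b" "bij d" using that pair_group_permutes permutes_bij unfolding ghx by blast+
    then have "inv' (b \<circ> d) = inv' d \<circ> inv' b" by (rule o_inv_distrib)
    then show ?thesis
      unfolding ghx by (simp add: pair_group_def sym_group_mult move_flag_def image_comp comp_assoc)
  qed
qed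

lemma pattern_conjugate:
  assumes \<tau>: "\<tau> \<in> carrier (sym_group n)" and b: "b \<in> graph_aut n E"
  shows "\<tau> \<circ> b \<circ> inv' \<tau> \<in> pattern_stabilizer n F \<longleftrightarrow> b \<in> B_set n E F \<tau>"
proof -
  have p: "\<tau> permutes {1..n}" "b permutes {1..n}"
    using \<tau> b by (simp_all add: graph_aut_def sym_group_carrier)
  have "\<tau> \<circ> b \<circ> inv' \<tau> permutes {1..n}"
    using p by (intro permutes_compose permutes_inv)
  moreover have "(\<tau> \<circ> b \<circ> inv' \<tau>) ` S = S \<longleftrightarrow> b ` inv' \<tau> ` S = inv' \<tau> ` S" for S
  proof -
    have 1: "\<tau> ` inv' \<tau> ` S = S"
      by (simp add: image_comp permutes_inv_o[OF p(1)])
    have "(\<tau> \<circ> b \<circ> inv' \<tau>) ` S = \<tau> ` b ` inv' \<tau> ` S"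
      by (simp add: image_comp comp_assoc)
    moreover have "\<tau> ` b ` inv' \<tau> ` S = \<tau> ` inv' \<tau> ` S \<longleftrightarrow> b ` inv' \<tau> ` S = inv' \<tau> ` S"
      using permutes_inj[OF p(1)] by (rule inj_image_eq_iff)
    ultimately show ?thesis using 1 by simp
  qed
  ultimately show ?thesis
    using b by (simp add: pattern_stabilizer_def B_set_def sym_group_carrier)
qed

text \<open>
  In an element \<open>(a, b)\<close> that fixes \<open>(\<tau>, e)\<close>, the component \<open>b\<close> determines \<open>a\<close>, and by
  \<open>pattern_conjugate\<close> the possible \<open>b\<close> are the elements of \<open>B\<^sub>\<tau>\<close> that fix \<open>e\<close>.
\<close>

lemma card_stabilizer_flag:
  assumes \<tau>: "\<tau> \<in> carrier (sym_group n)" and e: "e \<in> E"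
  shows "card (stabilizer (pair_group n E F) (flag_action n E) (\<tau>, e)) =
    card (stabilizer (B_group n E F \<tau>) (edge_action E) e)"
proof -
  have p: "\<tau> permutes {1..n}" using \<tau> by (simp add: sym_group_carrier)
  have solve: "a \<circ> \<tau> \<circ> inv' b = \<tau> \<longleftrightarrow> a = \<tau> \<circ> b \<circ> inv' \<tau>" if "b permutes {1..n}" for a b
  proof
    assume "a \<circ> \<tau> \<circ> inv' b = \<tau>"
    then have "a \<circ> \<tau> \<circ> inv' b \<circ> b \<circ> inv' \<tau> = \<tau> \<circ> b \<circ> inv' \<tau>" by simp
    then show "a = \<tau> \<circ> b \<circ> inv' \<tau>"
      using permutes_inverses[OF p] permutes_inverses[OF that] by (simp add: fun_eq_iff)
  next
    assume "a = \<tau> \<circ> b \<circ> inv' \<tau>"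
    then show "a \<circ> \<tau> \<circ> inv' b = \<tau>"
      using permutes_inverses[OF p] permutes_inverses[OF that] by (simp add: fun_eq_iff)
  qed
  have "stabilizer (pair_group n E F) (flag_action n E) (\<tau>, e) =
      (\<lambda>b. (\<tau> \<circ> b \<circ> inv' \<tau>, b)) ` stabilizer (B_group n E F \<tau>) (edge_action E) e" (is "?L = ?R")
  proof (rule Set.set_eqI)
    fix g :: "(nat \<Rightarrow> nat) \<times> (nat \<Rightarrow> nat)"
    obtain a b where g: "g = (a, b)" by (metis surj_pair)
    have perm: "b permutes {1..n}" if "b \<in> graph_aut n E"
      using that by (simp add: graph_aut_def sym_group_carrier)
    have B_sub: "B_set n E F \<tau> \<subseteq> graph_aut n E" by (auto simp: B_set_def)
    have "g \<in> ?L \<longleftrightarrow> a \<in> pattern_stabilizer n F \<and> b \<in> graph_aut n E \<and>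
        a \<circ> \<tau> \<circ> inv' b = \<tau> \<and> b ` e = e"
      using \<tau> e by (auto simp: g stabilizer_def carrier_pair_group flags_def move_flag_def)
    also have "\<dots> \<longleftrightarrow> a = \<tau> \<circ> b \<circ> inv' \<tau> \<and> b \<in> B_set n E F \<tau> \<and> b ` e = e"
    proof (cases "b \<in> graph_aut n E")
      case True
      have "a \<in> pattern_stabilizer n F \<longleftrightarrow> b \<in> B_set n E F \<tau>" if "a = \<tau> \<circ> b \<circ> inv' \<tau>"
        unfolding that by (rule pattern_conjugate[OF \<tau> True])
      then show ?thesis
        using True solve[OF perm[OF True], of a] by blast
    next
      case False
      then show ?thesis using B_sub by blast
    qed
    also have "\<dots> \<longleftrightarrow> g \<in> ?R"
      using e by (auto simp: g stabilizer_def B_group_def edge_action_def)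
    finally show "g \<in> ?L \<longleftrightarrow> g \<in> ?R" .
  qed
  then show ?thesis by (simp add: card_image inj_on_def)
qed

text \<open>
  The sum of the stabilizer sizes over all flags is evaluated in two ways: at once for the pair group,
  and for each fixed permutation \<open>\<tau>\<close> as a sum over the edges for the action of \<open>B\<^sub>\<tau>\<close>.
\<close>

lemma card_flag_orbits:
  assumes E: "E \<subseteq> two_subsets n"
  shows "card (orbits (pair_group n E F) (flags n E) (flag_action n E)) *
      (card (pattern_stabilizer n F) * card (graph_aut n E)) =
    (\<Sum>\<tau>\<in>carrier (sym_group n). card (B_set n E F \<tau>) * card (edge_orbits n E F \<tau>))"
proof -
  have finE: "finite E"
    using E by (rule finite_subset) (simp add: two_subsets_def)
  have sub: "pattern_stabilizer n F \<subseteq> carrier (sym_group n)" "graph_aut n E \<subseteq> carrier (sym_group n)"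
    "B_set n E F \<tau> \<subseteq> carrier (sym_group n)" for \<tau>
    by (auto simp: pattern_stabilizer_def graph_aut_def B_set_def)
  note fin = sub[THEN finite_subset, OF finite_sym_group]
  have "card (orbits (pair_group n E F) (flags n E) (flag_action n E)) * order (pair_group n E F) =
      (\<Sum>x\<in>flags n E. card (stabilizer (pair_group n E F) (flag_action n E) x))"
    using fin finE finite_sym_group
    by (intro group_action.sum_card_stabilizer[OF group_action_flags[OF E], symmetric])
      (auto simp: carrier_pair_group flags_def)
  also have "\<dots> = (\<Sum>\<tau>\<in>carrier (sym_group n). \<Sum>e\<in>E.
      card (stabilizer (pair_group n E F) (flag_action n E) (\<tau>, e)))"
    by (simp add: flags_def sum.cartesian_product)
  also have "\<dots> = (\<Sum>\<tau>\<in>carrier (sym_group n). \<Sum>e\<in>E.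
      card (stabilizer (B_group n E F \<tau>) (edge_action E) e))"
    by (intro sum.cong refl card_stabilizer_flag)
  also have "\<dots> = (\<Sum>\<tau>\<in>carrier (sym_group n). card (edge_orbits n E F \<tau>) * order (B_group n E F \<tau>))"
    unfolding edge_orbits_def
    by (intro sum.cong refl group_action.sum_card_stabilizer[OF group_action_edges[OF E]] finE)
      (simp add: B_group_def fin)
  finally show ?thesis
    by (simp add: order_def carrier_pair_group card_cartesian_product B_group_def ac_simps)
qed

section \<open>Arcs as flags\<close>

text \<open>The minimum and the maximum are just a canonical choice of the two ends.\<close>

definition edge_swap :: "nat set \<Rightarrow> nat \<Rightarrow> nat" where
  "edge_swap e = transpose (Min e) (Max e)"

lemma edge_swap_pair: "edge_swap {i, j} = transpose i j"
  by (cases "i \<le> j") (simp_all add: edge_swap_def min_def max_def transpose_commute)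

text \<open>An edge is the support of its transposition, so different edges give different arcs at a vertex.\<close>

lemma edge_swap_moves:
  assumes "card e = 2"
  shows "{x. edge_swap e x \<noteq> x} = e"
  using assms by (auto simp: card_2_iff edge_swap_pair transpose_def split: if_splits)

lemma edge_swap_image:
  assumes "bij b" "card e = 2"
  shows "edge_swap (b ` e) = b \<circ> edge_swap e \<circ> inv' b"
proof -
  obtain i j where e: "e = {i, j}" using assms(2) by (auto simp: card_2_iff)
  have "transpose (b i) (b j) x = b (transpose i j (inv' b x))" for x
  proof -
    obtain y where "x = b y" using bij_pointE[OF assms(1)] by blast
    then show ?thesis
      using bij_is_inj[OF assms(1)] by (simp add: transpose_def inj_eq)
  qed
  then show ?thesis by (simp add: e edge_swap_pair fun_eq_iff)
qed

definition flag_arc :: "nat \<Rightarrow> (nat \<Rightarrow> nat) \<times> nat set \<Rightarrow> vertex \<times> vertex" where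
  "flag_arc k = (\<lambda>(\<tau>, e). (Copy k \<tau>, Copy k (\<tau> \<circ> edge_swap e)))"

lemma coupling_transpositions_eq:
  assumes "E \<subseteq> two_subsets n"
  shows "coupling_transpositions E = edge_swap ` E"
proof
  show "coupling_transpositions E \<subseteq> edge_swap ` E"
    by (force simp: coupling_transpositions_def edge_swap_pair[symmetric])
  show "edge_swap ` E \<subseteq> coupling_transpositions E"
  proof clarify
    fix e assume e: "e \<in> E"
    then have "card e = 2" using assms by (auto simp: two_subsets_def)
    then obtain i j where "e = {i, j}" by (auto simp: card_2_iff)
    then show "edge_swap e \<in> coupling_transpositions E"
      using e by (auto simp: coupling_transpositions_def edge_swap_pair)
  qed
qed

lemma arcs_eq:
  assumes "E \<subseteq> two_subsets n"
  shows "arcs n E k = flag_arc k ` flags n E"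
  unfolding arcs_def coupling_transpositions_eq[OF assms]
  by (force simp: flag_arc_def flags_def)

lemma inj_on_flag_arc:
  assumes "E \<subseteq> two_subsets n"
  shows "inj_on (flag_arc k) (flags n E)"
proof (rule inj_onI, clarify)
  fix \<tau> e \<tau>' e'
  assume x: "(\<tau>, e) \<in> flags n E" "(\<tau>', e') \<in> flags n E"
    and eq: "flag_arc k (\<tau>, e) = flag_arc k (\<tau>', e')"
  then have \<tau>: "\<tau> = \<tau>'" "\<tau> \<circ> edge_swap e = \<tau> \<circ> edge_swap e'" by (auto simp: flag_arc_def)
  have "inj \<tau>" using x(1) permutes_inj by (auto simp: flags_def sym_group_carrier)
  then have "edge_swap e = edge_swap e'"
    using \<tau>(2) by (simp add: fun_eq_iff inj_eq)
  moreover have "card e = 2" "card e' = 2" using x assms by (auto simp: flags_def two_subsets_def)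
  ultimately have "e = e'" using edge_swap_moves by metis
  with \<tau>(1) show "\<tau> = \<tau>' \<and> e = e'" by simp
qed

text \<open>
  The head \<open>\<tau> \<circ> \<sigma>\<close> of an arc moves to \<open>a \<circ> \<tau> \<circ> \<sigma> \<circ> b\<inverse> = (a \<circ> \<tau> \<circ> b\<inverse>) \<circ> (b \<circ> \<sigma> \<circ> b\<inverse>)\<close>, and the
  conjugate of \<open>\<sigma>\<close> is the transposition of the image edge.
\<close>

lemma arc_action_flag_arc:
  assumes E: "E \<subseteq> two_subsets n" and k: "k \<in> {1..m}"
    and g: "(a, b) \<in> carrier (pair_group n E F)" and x: "x \<in> flags n E"
  shows "arc_action n E k (vertex_perm n m a b) (flag_arc k x) = flag_arc k (move_flag (a, b) x)"
proof -
  obtain \<tau> e where x_eq: "x = (\<tau>, e)" by (metis surj_pair)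
  have \<tau>: "\<tau> permutes {1..n}" and e: "e \<subseteq> {1..n}" "card e = 2"
    using x E by (auto simp: x_eq flags_def sym_group_carrier two_subsets_def)
  have b: "b permutes {1..n}" using pair_group_permutes[OF g] by blast
  obtain i j where "e = {i, j}" using e(2) by (auto simp: card_2_iff)
  then have "edge_swap e permutes {1..n}"
    using e(1) permutes_swap_id[of i "{1..n}" j] by (simp add: edge_swap_pair)
  then have \<sigma>: "\<tau> \<circ> edge_swap e permutes {1..n}" using \<tau> by (rule permutes_compose)
  have "a \<circ> (\<tau> \<circ> edge_swap e) \<circ> inv' b = a \<circ> \<tau> \<circ> inv' b \<circ> edge_swap (b ` e)"
    using permutes_inverses[OF b]
    by (simp add: edge_swap_image[OF permutes_bij[OF b] e(2)] fun_eq_iff)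
  moreover have "flag_arc k x \<in> arcs n E k" using x arcs_eq[OF E] by blast
  ultimately show ?thesis
    using k \<tau> \<sigma> by (simp add: x_eq arc_action_def flag_arc_def move_flag_def sym_group_carrier)
qed

lemma orbitals_eq:
  assumes E: "E \<subseteq> two_subsets n" and k: "k \<in> {1..m}"
  shows "orbitals n m E F k =
    (`) (flag_arc k) ` orbits (pair_group n E F) (flags n E) (flag_action n E)"
proof -
  have "orbit (G_X n m E F) (arc_action n E k) (flag_arc k x) =
      flag_arc k ` orbit (pair_group n E F) (flag_action n E) x" if x: "x \<in> flags n E" for x
  proof -
    have "orbit (G_X n m E F) (arc_action n E k) (flag_arc k x) =
        (\<lambda>(a, b). arc_action n E k (vertex_perm n m a b) (flag_arc k x)) ` carrier (pair_group n E F)"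
      by (force simp: orbit_def G_X_def carrier_pair_group)
    also have "\<dots> = (\<lambda>g. flag_arc k (move_flag g x)) ` carrier (pair_group n E F)"
      using arc_action_flag_arc[OF E k _ x] by (intro image_cong) auto
    also have "\<dots> = flag_arc k ` orbit (pair_group n E F) (flag_action n E) x"
      using x by (auto simp: orbit_def)
    finally show ?thesis .
  qed
  then show ?thesis
    unfolding orbitals_def orbits_def arcs_eq[OF E] Setcompr_eq_image Collect_mem_eq image_image
    by (rule image_cong[OF refl])
qed

lemma card_orbitals:
  assumes E: "E \<subseteq> two_subsets n" and k: "k \<in> {1..m}"
  shows "card (orbitals n m E F k) =
    card (orbits (pair_group n E F) (flags n E) (flag_action n E))"
proof -
  have "orbits (pair_group n E F) (flags n E) (flag_action n E) \<subseteq> Pow (flags n E)"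
    using group_action.orbits_coverture[OF group_action_flags[OF E]] by blast
  then have "inj_on ((`) (flag_arc k)) (orbits (pair_group n E F) (flags n E) (flag_action n E))"
    using inj_on_image_Pow[OF inj_on_flag_arc[OF E]] inj_on_subset by blast
  then show ?thesis by (simp add: orbitals_eq[OF E k] card_image)
qed

section \<open>The number of orbitals\<close>

theorem theorem3p10:
  fixes n m k :: nat and E :: "nat set set" and C :: "nat set list"
  assumes "n \<ge> 3"
    and "coupling_graph n E"
    and "quantum_circuit n m C"
    and "k \<in> {1..m}"
  defines "F \<equiv> fixing_pattern n (set C)"
    and "p \<equiv> card (pair_components n (set C))"
    and "f \<equiv> card (free_set n (set C))"
  shows "real (card (orbitals n m E F k)) =
    (\<Sum>\<tau>\<in>carrier (sym_group n). real (card (B_set n E F \<tau>)) * real (card (edge_orbits n E F \<tau>)))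
      / (2 ^ p * fact f * real (card (graph_aut n E)))"
proof -
  have E: "E \<subseteq> two_subsets n" and C: "set C \<subseteq> two_subsets n"
    using assms(2,3) by (simp_all add: coupling_graph_def quantum_circuit_def)
  have "id \<in> graph_aut n E"
    using subgroup.one_closed[OF subgroup_graph_aut] by (simp add: sym_group_one)
  moreover have "finite (graph_aut n E)"
    by (rule finite_subset[OF _ finite_sym_group]) (auto simp: graph_aut_def)
  ultimately have "card (graph_aut n E) \<noteq> 0" by auto
  moreover have "card (orbitals n m E F k) * (2 ^ p * fact f * card (graph_aut n E)) =
      (\<Sum>\<tau>\<in>carrier (sym_group n). card (B_set n E F \<tau>) * card (edge_orbits n E F \<tau>))"
    using card_flag_orbits[OF E, of F] card_pattern_stabilizer[OF C]
    by (simp add: card_orbitals[OF E assms(4)] F_def p_def f_def)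
  from this[THEN arg_cong[where f = real]]
  have "real (card (orbitals n m E F k)) * (2 ^ p * fact f * real (card (graph_aut n E))) =
      (\<Sum>\<tau>\<in>carrier (sym_group n). real (card (B_set n E F \<tau>)) * real (card (edge_orbits n E F \<tau>)))"
    by simp
  ultimately show ?thesis by (simp add: field_simps)
qed

end
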